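(* Let $n\ge1$, $m\ge 1$, $t\in[0,2)$, and let $P_k=(p_{k,i,j})_{i,j=1}^m$, $k=0,1,\dots,n$, be $m\times m$ matrices of complex-valued functions on $\mathbb{R}$ such that, for all $k,i,j$ and all $x\in\mathbb{R}$, $$p_{k,i,j}\in W_1^{n-k}[0,\pi],\quad p_{k,i,j}(x+\pi)=p_{k,i,j}(x),\quad p_{k,i,j}(-x)=\overline{p_{k,i,j}(x)},\quad \det P_0(x)\ne0 .$$ Let $L_t(n,m)$ be the operator generated in $L_2^m[0,\pi]$ by the differential expression $$l(n,m)\mathbf{y}=(-i)^nP_0\mathbf{y}^{(n)}+(-i)^{n-1}P_1\mathbf{y}^{(n-1)}+\dots+P_n\mathbf{y}$$ and the boundary conditions $$\mathbf{y}(\pi)=e^{i\pi t}\mathbf{y}(0),\ \mathbf{y}'(\pi)=e^{i\pi t}\mathbf{y}'(0),\ \dots,\ \mathbf{y}^{(n-1)}(\pi)=e^{i\pi t}\mathbf{y}^{(n-1)}(0).$$ If $\lambda$ is an eigenvalue of multiplicity $v$ of $L_t(n,m)$, then $\overline{\lambda}$ is also an eigenvalue of multiplicity $v$ of $L_t(n,m)$.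
   Context: $L_2^m[0,\pi]$ is the Hilbert space of square-integrable $\mathbb{C}^m$-valued functions on $[0,\pi]$. The domain of $L_t(n,m)$ consists of those $\mathbf{y}$ with $\mathbf{y},\dots,\mathbf{y}^{(n-1)}$ absolutely continuous on $[0,\pi]$ and $l(n,m)\mathbf{y}\in L_2^m[0,\pi]$ that satisfy the boundary conditions. $W_1^{s}[0,\pi]$ is the Sobolev space of functions with $s$ derivatives in $L_1[0,\pi]$ ($W_1^0=L_1$). The multiplicity of an eigenvalue is its algebraic multiplicity, i.e. the dimension of the space spanned by the eigenfunctions and associated functions (root functions) corresponding to it. *)

theory Defs
  imports
    "HOL-Analysis.Analysis"
    "HOL-Library.Extended_Nat"
    "HOL-Library.Function_Algebras"
begin

definition abs_continuous_on :: "real set \<Rightarrow> (real \<Rightarrow> 'a::real_normed_vector) \<Rightarrow> bool" where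
  "abs_continuous_on S f \<longleftrightarrow>
     (\<forall>\<epsilon>>0. \<exists>\<delta>>0. \<forall>\<D>. \<D> division_of \<Union>\<D> \<and> \<Union>\<D> \<subseteq> S \<and> (\<Sum>K\<in>\<D>. measure lborel K) < \<delta> \<longrightarrow>
        (\<Sum>K\<in>\<D>. norm (f (Sup K) - f (Inf K))) < \<epsilon>)"

text \<open>Derivatives are taken within \<open>S\<close>, so they are one-sided at the end points of an interval
  and do not depend on the values of the function outside \<open>S\<close>.\<close>

primrec iter_deriv_on ::
  "real set \<Rightarrow> nat \<Rightarrow> (real \<Rightarrow> 'a::real_normed_vector) \<Rightarrow> real \<Rightarrow> 'a" where
  "iter_deriv_on S 0 f = f"
| "iter_deriv_on S (Suc k) f = (\<lambda>x. vector_derivative (iter_deriv_on S k f) (at x within S))"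

text \<open>The derivatives of order below \<open>s\<close> exist everywhere on \<open>S\<close> and are absolutely continuous
  there. The derivative of order \<open>s\<close> then exists almost everywhere on an interval \<open>S\<close>; at the
  remaining points \<^const>\<open>vector_derivative\<close> has an unspecified value, so statements involving
  that derivative are only made up to null sets.\<close>

definition abs_continuous_derivs_on ::
  "real set \<Rightarrow> nat \<Rightarrow> (real \<Rightarrow> 'a::real_normed_vector) \<Rightarrow> bool" where
  "abs_continuous_derivs_on S s f \<longleftrightarrow>
     (\<forall>k<s. abs_continuous_on S (iter_deriv_on S k f)) \<and>
     (\<forall>k. Suc k < s \<longrightarrow> iter_deriv_on S k f differentiable_on S)"

text \<open>\<open>W\<^sub>1\<^sup>s\<close> on an interval \<open>S\<close>; for \<open>s > 0\<close> its members are identified with their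
  absolutely continuous representatives.\<close>

definition sobolev1 :: "nat \<Rightarrow> real set \<Rightarrow> (real \<Rightarrow> complex) set" where
  "sobolev1 s S = {f. abs_continuous_derivs_on S s f \<and> integrable (lebesgue_on S) (iter_deriv_on S s f)}"

definition square_integrable_on :: "(real \<Rightarrow> complex ^ 'm) \<Rightarrow> real set \<Rightarrow> bool"
    (infix "square'_integrable'_on" 46) where
  "f square_integrable_on S \<longleftrightarrow>
     f \<in> borel_measurable (lebesgue_on S) \<and> integrable (lebesgue_on S) (\<lambda>x. (norm (f x))\<^sup>2)"

definition vscale :: "complex \<Rightarrow> (real \<Rightarrow> complex ^ 'm) \<Rightarrow> real \<Rightarrow> complex ^ 'm" where
  "vscale c f = (\<lambda>x. c *s f x)"

global_interpretation vfun: vector_space "vscale :: complex \<Rightarrow> (real \<Rightarrow> complex ^ 'm) \<Rightarrow> _"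
  defines vspan = vfun.span and vdim = vfun.dim
  by unfold_locales
    (auto simp: vscale_def fun_eq_iff vec_eq_iff algebra_simps)

text \<open>The library function \<^const>\<open>vdim\<close> is 0 on infinite-dimensional spaces.\<close>

definition edim :: "(real \<Rightarrow> complex ^ 'm) set \<Rightarrow> enat" where
  "edim V = (if \<exists>B. finite B \<and> V \<subseteq> vspan B then enat (vdim V) else \<infinity>)"

definition diff_expr ::
  "nat \<Rightarrow> (nat \<Rightarrow> real \<Rightarrow> complex ^ 'm ^ 'm) \<Rightarrow> (real \<Rightarrow> complex ^ 'm) \<Rightarrow> real \<Rightarrow> complex ^ 'm" where
  "diff_expr n P y =
     (\<lambda>x. \<Sum>k\<le>n. (-\<i>) ^ (n - k) *s (P k x *v iter_deriv_on {0..pi} (n - k) y x))"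

text \<open>An element of the domain is a class of functions on \<open>[0,\<pi>]\<close> modulo null sets. It has
  exactly one continuous representative, and we extend that one by zero outside \<open>[0,\<pi>]\<close>. Hence
  distinct functions below are distinct elements of \<open>L\<^sub>2\<close>, and dimensions are the right ones.\<close>

definition Lt_domain ::
  "nat \<Rightarrow> (nat \<Rightarrow> real \<Rightarrow> complex ^ 'm ^ 'm) \<Rightarrow> real \<Rightarrow> (real \<Rightarrow> complex ^ 'm) set" where
  "Lt_domain n P t =
     {y. (\<forall>x. x \<notin> {0..pi} \<longrightarrow> y x = 0) \<and>
         abs_continuous_derivs_on {0..pi} n y \<and>
         diff_expr n P y square_integrable_on {0..pi} \<and>
         (\<forall>k<n. iter_deriv_on {0..pi} k y pi =
            exp (\<i> * complex_of_real (pi * t)) *s iter_deriv_on {0..pi} k y 0)}"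

text \<open>\<open>Lt_maps n P t y f\<close>: \<open>y\<close> lies in the domain of the operator, which maps it to the class
  of \<open>f\<close> in \<open>L\<^sub>2\<close>.\<close>

definition Lt_maps ::
  "nat \<Rightarrow> (nat \<Rightarrow> real \<Rightarrow> complex ^ 'm ^ 'm) \<Rightarrow> real \<Rightarrow>
   (real \<Rightarrow> complex ^ 'm) \<Rightarrow> (real \<Rightarrow> complex ^ 'm) \<Rightarrow> bool" where
  "Lt_maps n P t y f \<longleftrightarrow>
     y \<in> Lt_domain n P t \<and> (AE x in lebesgue_on {0..pi}. diff_expr n P y x = f x)"

definition is_eigenvalue ::
  "nat \<Rightarrow> (nat \<Rightarrow> real \<Rightarrow> complex ^ 'm ^ 'm) \<Rightarrow> real \<Rightarrow> complex \<Rightarrow> bool" where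
  "is_eigenvalue n P t \<mu> \<longleftrightarrow> (\<exists>y. y \<noteq> 0 \<and> Lt_maps n P t y (vscale \<mu> y))"

inductive_set root_functions ::
  "nat \<Rightarrow> (nat \<Rightarrow> real \<Rightarrow> complex ^ 'm ^ 'm) \<Rightarrow> real \<Rightarrow> complex \<Rightarrow> (real \<Rightarrow> complex ^ 'm) set"
  for n P t \<mu> where
  eigenfunction:
    "y \<noteq> 0 \<Longrightarrow> Lt_maps n P t y (vscale \<mu> y) \<Longrightarrow> y \<in> root_functions n P t \<mu>"
| associated_function:
    "z \<in> root_functions n P t \<mu> \<Longrightarrow> Lt_maps n P t y (vscale \<mu> y + z) \<Longrightarrow>
     y \<in> root_functions n P t \<mu>"

definition multiplicity_of ::
  "nat \<Rightarrow> (nat \<Rightarrow> real \<Rightarrow> complex ^ 'm ^ 'm) \<Rightarrow> real \<Rightarrow> complex \<Rightarrow> enat" where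
  "multiplicity_of n P t \<mu> = edim (vspan (root_functions n P t \<mu>))"

end

theory Submission
  imports Defs
begin

text \<open>
  The reason is a symmetry of the operator: if \<open>(J y)(x) = cnj (y(\<pi> - x))\<close>, then \<open>J\<close>
  is an antilinear involution that commutes with \<open>L\<^sub>t\<close>. Periodicity and the assumption on
  \<open>P k (- x)\<close> give \<open>P k (\<pi> - x) = cnj (P k x)\<close>. The sign that reflection puts in front
  of the derivative of order \<open>j\<close> agrees with \<open>cnj ((- \<i>)^j) = (- 1)^j (- \<i>)^j\<close>. The
  quasi-periodic boundary conditions are preserved, because reflection exchanges the end points and the
  factor \<open>exp (\<i> \<pi> t)\<close> has modulus 1. Hence \<open>J\<close> maps the root functions for
  \<open>\<mu>\<close> onto those for \<open>cnj \<mu>\<close> (\<open>root_functions_cnj\<close>), and being an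
  antilinear bijection it preserves dimensions (\<open>edim_conj_reflect\<close>).

  The one analytic point is the derivative of order \<open>n\<close>. For a member \<open>y\<close> of the domain it
  is the derivative of an absolutely continuous function, and the chain rule for \<open>J\<close> may be used
  only at points where it exists. So it must be known that an absolutely continuous function is
  differentiable almost everywhere (\<open>abs_continuous_on_differentiable_ae\<close>). This follows from
  Lebesgue's theorem for functions of bounded variation
  (\<open>bounded_variation_differentiable_ae\<close>), which is proved by Austin's method: at a point where the
  difference quotients of \<open>f\<close> oscillate, there are, at every scale, chords that run against the
  general direction of \<open>f\<close> on the surrounding interval of a partition. If such points formed a set
  of positive outer measure, then refining a partition along these chords would raise its sum by a fixed
  amount, which is impossible for a partition whose sum is already close to the total variation
  (\<open>outer_measure_oscillating_points_le\<close>).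
\<close>

section \<open>Outer measure of the set where a monotone function is steep\<close>

text \<open>Disjoint intervals can be lined up from left to right; the gaps between them only add
  nonnegative increments of a monotone function.\<close>
lemma mono_on_sum_increments_le:
  fixes \<phi> :: "real \<Rightarrow> real" and p q :: "'i \<Rightarrow> real"
  assumes "finite I" and "mono_on {a..b} \<phi>" and "a \<le> b"
    and "\<And>i. i \<in> I \<Longrightarrow> a \<le> p i \<and> p i \<le> q i \<and> q i \<le> b"
    and "pairwise (\<lambda>i j. disjnt {p i..q i} {p j..q j}) I"
  shows "(\<Sum>i\<in>I. \<phi> (q i) - \<phi> (p i)) \<le> \<phi> b - \<phi> a"
  using assms
proof (induction I arbitrary: b rule: finite_ranking_induct[where f = q])
  case (empty b)
  then show ?case by (auto simp: mono_on_def)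
next
  case (insert i I b)
  show ?case
  proof (cases "i \<in> I")
    case True
    with insert show ?thesis by (simp add: insert_absorb)
  next
    case False
    have i: "a \<le> p i" "p i \<le> q i" "q i \<le> b" using insert by auto
    have before: "q j \<le> p i" if "j \<in> I" for j
    proof -
      have "disjnt {p j..q j} {p i..q i}" using insert.prems(4) that False by (auto simp: pairwise_def)
      moreover have "p j \<le> q j" "q j \<le> q i" using insert that by auto
      ultimately show ?thesis using i unfolding disjnt_iff by (metis atLeastAtMost_iff linorder_le_cases order_refl order_trans)
    qed
    have "(\<Sum>j\<in>I. \<phi> (q j) - \<phi> (p j)) \<le> \<phi> (p i) - \<phi> a"
    proof (rule insert.IH)
      show "mono_on {a..p i} \<phi>" using insert.prems(1) i by (auto simp: mono_on_def)
      show "pairwise (\<lambda>i j. disjnt {p i..q i} {p j..q j}) I"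
        using insert.prems(4) by (auto simp: pairwise_def)
    qed (use insert before i in auto)
    moreover have "\<phi> (q i) \<le> \<phi> b" using insert.prems(1) i by (auto simp: mono_on_def)
    ultimately show ?thesis using False insert.hyps by simp
  qed
qed

text \<open>The exceptional sets below are not known to be measurable in advance, so they are measured from
  outside.\<close>
definition outer_measure_le :: "real set \<Rightarrow> real \<Rightarrow> bool" where
  "outer_measure_le S m \<longleftrightarrow> (\<exists>U. S \<subseteq> U \<and> U \<in> lmeasurable \<and> measure lebesgue U \<le> m)"

lemma outer_measure_le_Un: "outer_measure_le S m \<Longrightarrow> outer_measure_le T k \<Longrightarrow> outer_measure_le (S \<union> T) (m + k)"
  unfolding outer_measure_le_def
proof clarify
  fix U V assume *: "S \<subseteq> U" "U \<in> lmeasurable" "measure lebesgue U \<le> m" 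
    "T \<subseteq> V" "V \<in> lmeasurable" "measure lebesgue V \<le> k"
  have "measure lebesgue (U \<union> V) \<le> measure lebesgue U + measure lebesgue V"
    by (intro measure_Un_le) (use * in auto)
  with * show "\<exists>W. S \<union> T \<subseteq> W \<and> W \<in> lmeasurable \<and> measure lebesgue W \<le> m + k"
    by (intro exI[of _ "U \<union> V"]) auto
qed

lemma outer_measure_le_mono: "outer_measure_le T m \<Longrightarrow> S \<subseteq> T \<Longrightarrow> m \<le> k \<Longrightarrow> outer_measure_le S k"
  unfolding outer_measure_le_def by (meson order_trans)

lemma outer_measure_le_negligible: "negligible S \<Longrightarrow> outer_measure_le S 0"
  unfolding outer_measure_le_def
  by (intro exI[of _ S]) (auto simp: negligible_iff_measure)

lemma negligible_if_outer_measure_le: "(\<And>e. e > 0 \<Longrightarrow> outer_measure_le S e) \<Longrightarrow> negligible S"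
  unfolding outer_measure_le_def negligible_outer_le by blast

text \<open>The chord may lie anywhere around \<open>x\<close>. In this form the condition covers left and right
  difference quotients at once, and the intervals \<open>{p..q}\<close> form a Vitali cover of the
  points that satisfy it.\<close>
definition steep_near :: "real \<Rightarrow> (real \<Rightarrow> real) \<Rightarrow> real \<Rightarrow> bool" where
  "steep_near r \<phi> x \<longleftrightarrow> (\<forall>d>0. \<exists>p q. p \<le> x \<and> x \<le> q \<and> p < q \<and> q - p < d \<and> r * (q - p) \<le> \<phi> q - \<phi> p)"

text \<open>By Vitali's theorem, disjoint intervals with steep chords cover the set up to a null set. On each of
  them \<open>\<phi>\<close> gains at least \<open>r\<close> times the length, and a monotone function has only
  \<open>\<phi> b - \<phi> a\<close> to spend.\<close>
lemma outer_measure_steep_points_le: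
  fixes \<phi> :: "real \<Rightarrow> real"
  assumes "mono_on {a..b} \<phi>" and ab: "a \<le> b" and r: "r > 0"
    and S: "S \<subseteq> {a<..<b}" "\<And>x. x \<in> S \<Longrightarrow> steep_near r \<phi> x"
  shows "outer_measure_le S ((\<phi> b - \<phi> a) / r)"
proof -
  define K where "K = {(p, q). a \<le> p \<and> p < q \<and> q \<le> b \<and> r * (q - p) \<le> \<phi> q - \<phi> p}"
  let ?c = "\<lambda>(p, q). (p + q) / 2 :: real" and ?r = "\<lambda>(p, q). (q - p) / 2 :: real"
  have ball: "cball (?c i) (?r i) = {fst i..snd i}" for i
    by (auto simp: cball_eq_atLeastAtMost field_simps split: prod.splits)
  have fine: "\<exists>i. i \<in> K \<and> x \<in> cball (?c i) (?r i) \<and> ?r i < d" if "x \<in> S" "d > 0" for x d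
  proof -
    \<comment> \<open>Chords shorter than the distance to the end points stay inside \<open>{a..b}\<close>.\<close>
    define e where "e = Min {d, x - a, b - x}"
    have "e > 0" "e \<le> d" "e \<le> x - a" "e \<le> b - x" using that S by (auto simp: e_def)
    with S that obtain p q where pq: "p \<le> x" "x \<le> q" "p < q" "q - p < e" "r * (q - p) \<le> \<phi> q - \<phi> p"
      unfolding steep_near_def by blast
    then show ?thesis unfolding ball
      by (intro exI[of _ "(p, q)"]) (use \<open>e \<le> d\<close> \<open>e \<le> x - a\<close> \<open>e \<le> b - x\<close> in \<open>auto simp: K_def\<close>)
  qed
  have pos: "0 < ?r i" if "i \<in> K" for i using that by (auto simp: K_def)
  obtain C where C: "countable C" "C \<subseteq> K"
     "pairwise (\<lambda>i j. disjnt (cball (?c i) (?r i)) (cball (?c j) (?r j))) C"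
     "negligible (S - (\<Union>i \<in> C. cball (?c i) (?r i)))"
    using Vitali_covering_theorem_cballs[of K ?r S ?c, OF pos fine] by blast
  let ?I = "\<lambda>i. {fst i..snd i} :: real set"
  have finite_bound: "measure lebesgue (\<Union>i\<in>D. ?I i) \<le> (\<phi> b - \<phi> a) / r" if D: "D \<subseteq> C" "finite D" for D
  proof -
    have DK: "a \<le> fst i \<and> fst i < snd i \<and> snd i \<le> b \<and> r * (snd i - fst i) \<le> \<phi> (snd i) - \<phi> (fst i)" if "i \<in> D" for i
      using that D(1) C(2) by (auto simp: K_def)
    have "r * measure lebesgue (\<Union>i\<in>D. ?I i) \<le> r * (\<Sum>i\<in>D. measure lebesgue (?I i))"
      using r that by (intro mult_left_mono measure_UNION_le) auto
    also have "\<dots> = (\<Sum>i\<in>D. r * (snd i - fst i))"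
      unfolding sum_distrib_left using DK by (intro sum.cong) (auto simp: less_imp_le)
    also have "\<dots> \<le> (\<Sum>i\<in>D. \<phi> (snd i) - \<phi> (fst i))"
      using DK by (intro sum_mono) auto
    also have "\<dots> \<le> \<phi> b - \<phi> a"
    proof (rule mono_on_sum_increments_le[OF that(2) assms(1) ab])
      show "pairwise (\<lambda>i j. disjnt {fst i..snd i} {fst j..snd j}) D"
        using pairwise_subset[OF C(3) D(1)] unfolding ball .
    qed (use DK in \<open>auto simp: less_imp_le\<close>)
    finally show ?thesis using r by (simp add: field_simps)
  qed
  have "(\<Union>i\<in>C. ?I i) \<in> lmeasurable" "measure lebesgue (\<Union>i\<in>C. ?I i) \<le> (\<phi> b - \<phi> a) / r"
    using fmeasurable_UN_bound[of C ?I lebesgue] measure_UN_bound[of C ?I lebesgue] C(1) finite_bound by auto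
  then have "outer_measure_le (\<Union>i\<in>C. ?I i) ((\<phi> b - \<phi> a) / r)" unfolding outer_measure_le_def by blast
  then have "outer_measure_le ((\<Union>i\<in>C. ?I i) \<union> (S - (\<Union>i\<in>C. ?I i))) ((\<phi> b - \<phi> a) / r + 0)"
    using C(4) unfolding ball by (intro outer_measure_le_Un outer_measure_le_negligible)
  then show ?thesis by (rule outer_measure_le_mono) auto
qed

section \<open>Functions of bounded variation are differentiable almost everywhere\<close>

text \<open>Partitions enter only through induction that appends one more node on the right, so the sums are
  generated in this way and no set of subintervals is carried along.\<close>
inductive partition_sum :: "(real \<Rightarrow> real) \<Rightarrow> real \<Rightarrow> real \<Rightarrow> real \<Rightarrow> bool" for f a where
  start: "partition_sum f a a 0"
| snoc: "partition_sum f a x s \<Longrightarrow> x \<le> y \<Longrightarrow> partition_sum f a y (s + \<bar>f y - f x\<bar>)"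

lemma partition_sum_le: "partition_sum f a x s \<Longrightarrow> a \<le> x"
  by (induction rule: partition_sum.induct) auto

definition bounded_variation :: "(real \<Rightarrow> real) \<Rightarrow> real \<Rightarrow> real \<Rightarrow> bool" where
  "bounded_variation f a b \<longleftrightarrow> (\<exists>B. \<forall>x s. partition_sum f a x s \<longrightarrow> x \<le> b \<longrightarrow> s \<le> B)"

definition variation :: "(real \<Rightarrow> real) \<Rightarrow> real \<Rightarrow> real \<Rightarrow> real" where
  "variation f a x = Sup {s. partition_sum f a x s}"

lemma partition_sum_le_variation:
  assumes "bounded_variation f a b" "partition_sum f a x s" "x \<le> b"
  shows "s \<le> variation f a x"
  unfolding variation_def
  using assms by (intro cSup_upper) (auto simp: bounded_variation_def bdd_above_def)

text \<open>Appending the node \<open>y\<close> to a partition of \<open>{a..x}\<close> gives a partition of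
  \<open>{a..y}\<close>. So \<open>variation f a - f\<close> and \<open>variation f a + f\<close>
  are nondecreasing, which is what the key estimate rests on.\<close>
lemma increment_le_variation:
  assumes "bounded_variation f a b" and "a \<le> x" "x \<le> y" "y \<le> b"
  shows "\<bar>f y - f x\<bar> \<le> variation f a y - variation f a x"
proof -
  have "variation f a x \<le> variation f a y - \<bar>f y - f x\<bar>"
    unfolding variation_def[of f a x]
  proof (rule cSup_least)
    show "{s. partition_sum f a x s} \<noteq> {}"
      using snoc[OF start, of a x f] assms by auto
    fix s assume "s \<in> {s. partition_sum f a x s}"
    then have "s + \<bar>f y - f x\<bar> \<le> variation f a y"
      using assms by (intro partition_sum_le_variation[OF assms(1)] snoc) auto
    then show "s \<le> variation f a y - \<bar>f y - f x\<bar>" by simp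
  qed
  then show ?thesis by simp
qed

lemma mono_on_variation:
  assumes "bounded_variation f a b"
  shows "mono_on {a..b} (variation f a)"
  using increment_le_variation[OF assms] by (fastforce intro!: mono_onI)

lemma bounded_variation_add_linear:
  assumes "bounded_variation f a b"
  shows "bounded_variation (\<lambda>x. f x + c * x) a b"
proof -
  have *: "\<exists>s'. partition_sum f a x s' \<and> s \<le> s' + \<bar>c\<bar> * (x - a)"
    if "partition_sum (\<lambda>x. f x + c * x) a x s" for x s
    using that
  proof (induction rule: partition_sum.induct)
    case start
    show ?case using partition_sum.start by fastforce
  next
    case (snoc x s y)
    then obtain s' where s': "partition_sum f a x s'" "s \<le> s' + \<bar>c\<bar> * (x - a)" by blast
    have "\<bar>(f y + c * y) - (f x + c * x)\<bar> \<le> \<bar>f y - f x\<bar> + \<bar>c * (y - x)\<bar>"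
      by (simp add: algebra_simps)
    also have "\<bar>c * (y - x)\<bar> = \<bar>c\<bar> * (y - x)" using snoc by (simp add: abs_mult)
    finally have "s + \<bar>(f y + c * y) - (f x + c * x)\<bar> \<le> (s' + \<bar>f y - f x\<bar>) + \<bar>c\<bar> * (y - a)"
      using s' by (simp add: algebra_simps)
    then show ?case using partition_sum.snoc[OF s'(1) snoc(2)] by blast
  qed
  obtain B where B: "\<And>x s. partition_sum f a x s \<Longrightarrow> x \<le> b \<Longrightarrow> s \<le> B"
    using assms by (auto simp: bounded_variation_def)
  have "s \<le> B + \<bar>c\<bar> * (b - a)" if "partition_sum (\<lambda>x. f x + c * x) a x s" "x \<le> b" for x s
  proof -
    from *[OF that(1)] obtain s' where "partition_sum f a x s'" "s \<le> s' + \<bar>c\<bar> * (x - a)" by blast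
    moreover have "\<bar>c\<bar> * (x - a) \<le> \<bar>c\<bar> * (b - a)" using that by (intro mult_left_mono) auto
    ultimately show ?thesis using B[of x s'] that by linarith
  qed
  then show ?thesis unfolding bounded_variation_def by blast
qed

text \<open>The key estimate, an idea of Austin. On a subinterval \<open>{x..y}\<close> of the partition, look
  at the chords of \<open>f\<close> that run against the sign of \<open>f y - f x\<close>. Each point of
  \<open>E\<close> has them at arbitrarily small scale. The sum of the variation and
  \<open>\<plusminus>f\<close>, with the sign opposite to that of \<open>f y - f x\<close>, is monotone
  and rises steeply along these chords, yet its total increment is only the part of the variation on
  \<open>{x..y}\<close> that \<open>\<bar>f y - f x\<bar>\<close> fails to account for. Added up over the
  partition, this defect is the variation minus the partition sum.\<close>
lemma outer_measure_oscillating_points_le: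
  assumes bv: "bounded_variation f a b" and r: "r > 0"
    and E: "\<And>x. x \<in> E \<Longrightarrow> steep_near r f x \<and> steep_near r (\<lambda>x. - f x) x"
    and "partition_sum f a x s" "x \<le> b"
  shows "outer_measure_le (E \<inter> {a..x}) ((variation f a x - s) / r)"
  using assms(4,5)
proof (induction rule: partition_sum.induct)
  case start
  have "0 \<le> variation f a a"
    using partition_sum_le_variation[OF bv] start partition_sum.start by blast
  moreover have "outer_measure_le (E \<inter> {a..a}) 0"
    by (intro outer_measure_le_negligible) (auto intro: negligible_subset[of "{a}"])
  ultimately show ?case using r by (auto intro: outer_measure_le_mono)
next
  case (snoc x s y)
  have ax: "a \<le> x" using snoc partition_sum_le by blast
  define \<sigma> where "\<sigma> = (if f x \<le> f y then - 1 else 1 :: real)"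
  define \<phi> where "\<phi> = (\<lambda>z. variation f a z + \<sigma> * f z)"
  have inc: "\<bar>\<sigma> * f w - \<sigma> * f z\<bar> \<le> variation f a w - variation f a z" if "x \<le> z" "z \<le> w" "w \<le> y" for z w
    using increment_le_variation[OF bv, of z w] that ax snoc by (auto simp: \<sigma>_def)
  have mono: "mono_on {x..y} \<phi>"
    using inc unfolding \<phi>_def by (intro mono_onI) (fastforce simp: abs_if split: if_splits)
  have "outer_measure_le (E \<inter> {x<..<y}) ((\<phi> y - \<phi> x) / r)"
  proof (rule outer_measure_steep_points_le[OF mono])
    fix z assume z: "z \<in> E \<inter> {x<..<y}"
    have st: "steep_near r (\<lambda>w. \<sigma> * f w) z" using E z by (auto simp: \<sigma>_def)
    show "steep_near r \<phi> z"
      unfolding steep_near_def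
    proof clarify
      fix d :: real assume "d > 0"
      define e where "e = Min {d, z - x, y - z}"
      have e: "e > 0" "e \<le> d" "e \<le> z - x" "e \<le> y - z" using z \<open>d > 0\<close> by (auto simp: e_def)
      with st obtain p q where pq: "p \<le> z" "z \<le> q" "p < q" "q - p < e" "r * (q - p) \<le> \<sigma> * f q - \<sigma> * f p"
        unfolding steep_near_def by blast
      have "variation f a p \<le> variation f a q" using inc[of p q] pq e by auto
      then show "\<exists>p q. p \<le> z \<and> z \<le> q \<and> p < q \<and> q - p < d \<and> r * (q - p) \<le> \<phi> q - \<phi> p"
        using pq e by (intro exI[of _ p] exI[of _ q]) (auto simp: \<phi>_def)
    qed
  qed (use snoc r in auto)
  moreover have "\<phi> y - \<phi> x = variation f a y - variation f a x - \<bar>f y - f x\<bar>"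
    by (auto simp: \<phi>_def \<sigma>_def)
  ultimately have "outer_measure_le ((E \<inter> {x<..<y}) \<union> {y}) ((variation f a y - variation f a x - \<bar>f y - f x\<bar>) / r + 0)"
    by (intro outer_measure_le_Un outer_measure_le_negligible) (simp_all only: negligible_sing)
  moreover have "outer_measure_le (E \<inter> {a..x}) ((variation f a x - s) / r)"
    using snoc by auto
  ultimately have "outer_measure_le ((E \<inter> {a..x}) \<union> ((E \<inter> {x<..<y}) \<union> {y}))
     ((variation f a x - s) / r + ((variation f a y - variation f a x - \<bar>f y - f x\<bar>) / r + 0))"
    using outer_measure_le_Un by blast
  then show ?case
    by (rule outer_measure_le_mono) (auto simp: diff_divide_distrib add_divide_distrib)
qed

text \<open>A partition sum can be chosen as close to the variation as desired.\<close>
lemma negligible_oscillating_points: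
  assumes bv: "bounded_variation f a b" and r: "r > 0" and ab: "a \<le> b"
  shows "negligible {x \<in> {a..b}. steep_near r f x \<and> steep_near r (\<lambda>x. - f x) x}"
    (is "negligible ?E")
proof (rule negligible_if_outer_measure_le)
  fix e :: real assume "e > 0"
  have "partition_sum f a b (0 + \<bar>f b - f a\<bar>)" by (intro snoc start ab)
  then have ne: "{s. partition_sum f a b s} \<noteq> {}" by blast
  have "\<exists>s. partition_sum f a b s \<and> variation f a b - r * e < s"
    using less_cSupD[OF ne, of "variation f a b - r * e"] \<open>e > 0\<close> r by (auto simp: variation_def)
  then obtain s where s: "partition_sum f a b s" "variation f a b - r * e < s" by blast
  have "outer_measure_le (?E \<inter> {a..b}) ((variation f a b - s) / r)"
    by (rule outer_measure_oscillating_points_le[OF bv r]) (use s in auto)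
  then show "outer_measure_le ?E e"
    by (rule outer_measure_le_mono) (use s r in \<open>auto simp: field_simps\<close>)
qed

lemma negligible_infinitely_steep_points:
  assumes bv: "bounded_variation f a b" and ab: "a \<le> b"
  shows "negligible {x \<in> {a<..<b}. \<forall>r>0. steep_near r (variation f a) x}"
    (is "negligible ?E")
proof (rule negligible_if_outer_measure_le)
  fix e :: real assume "e > 0"
  let ?V = "variation f a b - variation f a a"
  have V: "?V \<ge> 0" using mono_on_variation[OF bv] ab by (auto simp: mono_on_def)
  \<comment> \<open>The summand 1 keeps the slope positive when the variation vanishes.\<close>
  define r where "r = ?V / e + 1"
  have r: "r > 0" using V \<open>e > 0\<close> by (auto simp: r_def intro: add_nonneg_pos)
  have "outer_measure_le ?E (?V / r)"
    by (rule outer_measure_steep_points_le[OF mono_on_variation[OF bv] ab r]) (use r in auto)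
  moreover have "?V / r \<le> e" 
  proof -
    have "?V \<le> e * r" using \<open>e > 0\<close> by (simp add: r_def field_simps)
    then show ?thesis using r by (simp add: field_simps)
  qed
  ultimately show "outer_measure_le ?E e" using outer_measure_le_mono by blast
qed

lemma tendsto_if_no_oscillation:
  fixes g :: "'a \<Rightarrow> real"
  assumes F: "F \<noteq> bot" and bdd: "\<forall>\<^sub>F y in F. \<bar>g y\<bar> < M"
    and osc: "\<And>p q. p \<in> \<rat> \<Longrightarrow> q \<in> \<rat> \<Longrightarrow> p < q \<Longrightarrow> (\<exists>\<^sub>F y in F. g y < p) \<Longrightarrow> (\<exists>\<^sub>F y in F. q < g y) \<Longrightarrow> False"
  shows "\<exists>l. (g \<longlongrightarrow> l) F"
proof -
  let ?l = "Liminf F (\<lambda>y. ereal (g y))" and ?u = "Limsup F (\<lambda>y. ereal (g y))"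
  have "?u \<le> ?l"
  proof (rule ccontr)
    assume "\<not> ?u \<le> ?l"
    then obtain c where c: "?l < ereal c" "ereal c < ?u" using ereal_dense2 by (metis not_le)
    then obtain d where d: "ereal c < ereal d" "ereal d < ?u" using ereal_dense2 by blast
    obtain c' d' where q: "c < c'" "c' < d'" "d' < d" "c' \<in> \<rat>" "d' \<in> \<rat>"
      using Rats_dense_in_real[of c d] Rats_dense_in_real d(1) by (metis ereal_less(1) less_ereal.simps(1))
    have "\<exists>\<^sub>F y in F. g y < c'"
    proof (rule ccontr)
      assume "\<not> (\<exists>\<^sub>F y in F. g y < c')"
      then have "\<forall>\<^sub>F y in F. ereal c' \<le> ereal (g y)" by (simp add: not_frequently not_less)
      then have "ereal c' \<le> ?l" by (rule Liminf_bounded)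
      then show False using c(1) q(1) by (meson ereal_less_eq(3) less_le_not_le order_trans less_imp_le)
    qed
    moreover have "\<exists>\<^sub>F y in F. d' < g y"
    proof (rule ccontr)
      assume "\<not> (\<exists>\<^sub>F y in F. d' < g y)"
      then have "\<forall>\<^sub>F y in F. ereal (g y) \<le> ereal d'" by (simp add: not_frequently not_less)
      then have "?u \<le> ereal d'" by (rule Limsup_bounded)
      then show False using d(2) q(3) by (meson ereal_less_eq(3) less_le_not_le order_trans less_imp_le)
    qed
    ultimately show False using osc q by blast
  qed
  then have eq: "?u = ?l" using Liminf_le_Limsup[OF F] by (metis antisym)
  have lim: "((\<lambda>y. ereal (g y)) \<longlongrightarrow> ?l) F" using tendsto_Liminf[OF F eq] .
  have "?u \<le> ereal M" by (rule Limsup_bounded) (use bdd in \<open>auto elim!: eventually_mono\<close>)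
  moreover have "ereal (- M) \<le> ?l" by (rule Liminf_bounded) (use bdd in \<open>auto elim!: eventually_mono\<close>)
  ultimately obtain l where "?l = ereal l" using eq by (cases ?l) auto
  with lim show ?thesis by auto
qed

lemma steep_near_if_frequently:
  assumes "\<exists>\<^sub>F y in at x. r \<le> (\<phi> y - \<phi> x) / (y - x)"
  shows "steep_near r \<phi> x"
  unfolding steep_near_def
proof clarify
  fix d :: real assume "d > 0"
  have "\<forall>\<^sub>F y in at x. y \<noteq> x \<and> dist y x < d" 
    using \<open>d > 0\<close> by (auto simp: eventually_at)
  then obtain y where y: "r \<le> (\<phi> y - \<phi> x) / (y - x)" "y \<noteq> x" "\<bar>y - x\<bar> < d"
    using frequently_eventually_frequently[OF assms] by (auto simp: dist_real_def dest: frequently_ex)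
  show "\<exists>p q. p \<le> x \<and> x \<le> q \<and> p < q \<and> q - p < d \<and> r * (q - p) \<le> \<phi> q - \<phi> p"
  proof (cases "x < y")
    case True
    with y show ?thesis by (intro exI[of _ x] exI[of _ y]) (auto simp: field_simps)
  next
    case False
    with y have "y < x" by auto
    with y show ?thesis by (intro exI[of _ y] exI[of _ x]) (auto simp: field_simps)
  qed
qed

text \<open>If the difference quotient at \<open>x\<close> has no limit, then either it is unbounded near
  \<open>x\<close>, and then so are the chord slopes of the variation, or it oscillates across two
  rationals \<open>p < q\<close>. Subtracting the line of slope \<open>(p + q) / 2\<close> turns the
  latter into oscillation across \<open>\<plusminus>(q - p) / 2\<close>.\<close>
lemma differentiable_at_if_not_exceptional:
  assumes bv: "bounded_variation f a b" and x: "a < x" "x < b"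
    and finite: "\<not> (\<forall>r>0. steep_near r (variation f a) x)"
    and osc: "\<And>p q. p \<in> \<rat> \<Longrightarrow> q \<in> \<rat> \<Longrightarrow> p < q \<Longrightarrow>
      \<not> (steep_near ((q - p) / 2) (\<lambda>y. f y + (- (p + q) / 2) * y) x \<and>
         steep_near ((q - p) / 2) (\<lambda>y. - (f y + (- (p + q) / 2) * y)) x)"
  shows "f differentiable (at x)"
proof -
  let ?g = "\<lambda>y. (f y - f x) / (y - x)"
  have near: "\<forall>\<^sub>F y in at x. y \<noteq> x \<and> a < y \<and> y < b"
    using eventually_at_in_open[of "{a<..<b}" x] x by (auto elim: eventually_mono)
  from finite obtain r where r: "r > 0" "\<not> steep_near r (variation f a) x" by blast
  have bdd: "\<forall>\<^sub>F y in at x. \<bar>?g y\<bar> < r"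
  proof (rule ccontr)
    assume "\<not> ?thesis"
    then have "\<exists>\<^sub>F y in at x. r \<le> \<bar>?g y\<bar>" by (simp add: not_eventually not_less)
    from frequently_eventually_frequently[OF this near]
    have "\<exists>\<^sub>F y in at x. r \<le> (variation f a y - variation f a x) / (y - x)"
    proof (rule frequently_elim1)
      fix y assume y: "r \<le> \<bar>?g y\<bar> \<and> y \<noteq> x \<and> a < y \<and> y < b"
      show "r \<le> (variation f a y - variation f a x) / (y - x)"
      proof (cases "x < y")
        case True
        then show ?thesis using y x increment_le_variation[OF bv, of x y] 
          by (auto simp: field_simps abs_div)
      next
        case False
        then show ?thesis using y x increment_le_variation[OF bv, of y x] 
          by (auto simp: field_simps abs_div abs_minus_commute)
      qed
    qed
    then show False using r(2) steep_near_if_frequently by blast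
  qed
  have "\<exists>l. (?g \<longlongrightarrow> l) (at x)"
  proof (rule tendsto_if_no_oscillation[OF _ bdd])
    fix p q :: real assume pq: "p \<in> \<rat>" "q \<in> \<rat>" "p < q"
      and below: "\<exists>\<^sub>F y in at x. ?g y < p" and above: "\<exists>\<^sub>F y in at x. q < ?g y"
    let ?h = "\<lambda>y. f y + (- (p + q) / 2) * y"
    have h: "(?h y - ?h x) / (y - x) = ?g y - (p + q) / 2" 
      "(- ?h y - - ?h x) / (y - x) = (p + q) / 2 - ?g y" if "y \<noteq> x" for y
      using that by (simp_all add: field_simps)
    have mid: "q < s \<Longrightarrow> (q - p) / 2 \<le> s - (p + q) / 2" 
      "s < p \<Longrightarrow> (q - p) / 2 \<le> (p + q) / 2 - s" for s
      by (simp_all add: field_simps)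
    have "steep_near ((q - p) / 2) ?h x"
    proof (rule steep_near_if_frequently, rule frequently_elim1[OF frequently_eventually_frequently[OF above near]])
      fix y assume y: "q < ?g y \<and> y \<noteq> x \<and> a < y \<and> y < b"
      then have "y \<noteq> x" by blast
      show "(q - p) / 2 \<le> (?h y - ?h x) / (y - x)"
        unfolding h[OF \<open>y \<noteq> x\<close>] using y mid by blast
    qed
    moreover have "steep_near ((q - p) / 2) (\<lambda>y. - ?h y) x"
    proof (rule steep_near_if_frequently, rule frequently_elim1[OF frequently_eventually_frequently[OF below near]])
      fix y assume y: "?g y < p \<and> y \<noteq> x \<and> a < y \<and> y < b"
      then have "y \<noteq> x" by blast
      show "(q - p) / 2 \<le> (- ?h y - - ?h x) / (y - x)"
        unfolding h[OF \<open>y \<noteq> x\<close>] using y mid by blast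
    qed
    ultimately show False using osc[OF pq] by blast
  qed auto
  then show ?thesis
    by (metis has_field_derivative_iff real_differentiable_def)
qed

text \<open>Lebesgue's theorem. Only countably many pairs of rationals are needed to detect oscillation.\<close>
theorem bounded_variation_differentiable_ae:
  assumes bv: "bounded_variation f a b" and ab: "a \<le> b"
  shows "negligible {x \<in> {a<..<b}. \<not> f differentiable (at x)}"
proof -
  let ?I = "{x \<in> {a<..<b}. \<forall>r>0. steep_near r (variation f a) x}"
  let ?O = "\<lambda>(p, q). {x \<in> {a..b}. steep_near ((q - p) / 2) (\<lambda>y. f y + (- (p + q) / 2) * y) x \<and>
         steep_near ((q - p) / 2) (\<lambda>y. - (f y + (- (p + q) / 2) * y)) x}"
  let ?Q = "{(p, q). p \<in> \<rat> \<and> q \<in> \<rat> \<and> p < (q :: real)}"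
  have "countable ?Q"
    by (rule countable_subset[of _ "\<rat> \<times> \<rat>"]) (auto simp: countable_rat)
  then have "negligible (\<Union>pq\<in>?Q. ?O pq)"
  proof (intro negligible_countable_Union)
    fix X assume "X \<in> ?O ` ?Q"
    then obtain p q where "p < q" and X: "X = ?O (p, q)" by blast
    then show "negligible X"
      unfolding X case_prod_conv
      by (intro negligible_oscillating_points bounded_variation_add_linear bv ab) simp
  qed (rule countable_image)
  then have "negligible (?I \<union> (\<Union>pq\<in>?Q. ?O pq))"
    by (intro negligible_Un negligible_infinitely_steep_points bv ab)
  then show ?thesis
  proof (rule negligible_subset, intro subsetI)
    fix x assume x: "x \<in> {x \<in> {a<..<b}. \<not> f differentiable (at x)}"
    show "x \<in> ?I \<union> (\<Union>pq\<in>?Q. ?O pq)"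
    proof (rule ccontr)
      assume "x \<notin> ?I \<union> (\<Union>pq\<in>?Q. ?O pq)"
      then have "f differentiable (at x)"
        using x by (intro differentiable_at_if_not_exceptional[OF bv]) (auto simp: less_imp_le)
      with x show False by simp
    qed
  qed
qed

section \<open>Absolutely continuous functions are differentiable almost everywhere\<close>

text \<open>Besides passing to components, this allows the function to be changed outside \<open>S\<close>.\<close>
lemma abs_continuous_on_dominated:
  fixes f :: "real \<Rightarrow> 'a::real_normed_vector" and g :: "real \<Rightarrow> 'b::real_normed_vector"
  assumes f: "abs_continuous_on S f"
    and le: "\<And>x y. x \<in> S \<Longrightarrow> y \<in> S \<Longrightarrow> norm (g x - g y) \<le> norm (f x - f y)"
  shows "abs_continuous_on S g"
  unfolding abs_continuous_on_def
proof (intro allI impI)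
  fix \<epsilon> :: real assume "\<epsilon> > 0"
  then obtain \<delta> where \<delta>: "\<delta> > 0" "\<And>\<D>. \<D> division_of \<Union>\<D> \<Longrightarrow> \<Union>\<D> \<subseteq> S \<Longrightarrow> (\<Sum>K\<in>\<D>. measure lborel K) < \<delta> \<Longrightarrow>
      (\<Sum>K\<in>\<D>. norm (f (Sup K) - f (Inf K))) < \<epsilon>"
    using f unfolding abs_continuous_on_def by meson
  show "\<exists>\<delta>>0. \<forall>\<D>. \<D> division_of \<Union>\<D> \<and> \<Union>\<D> \<subseteq> S \<and> (\<Sum>K\<in>\<D>. measure lborel K) < \<delta> \<longrightarrow>
        (\<Sum>K\<in>\<D>. norm (g (Sup K) - g (Inf K))) < \<epsilon>"
  proof (intro exI[of _ \<delta>] conjI allI impI \<delta>(1); elim conjE)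
    fix \<D> :: "real set set" assume D: "\<D> division_of \<Union>\<D>" "\<Union>\<D> \<subseteq> S" "(\<Sum>K\<in>\<D>. measure lborel K) < \<delta>"
    have "(\<Sum>K\<in>\<D>. norm (g (Sup K) - g (Inf K))) \<le> (\<Sum>K\<in>\<D>. norm (f (Sup K) - f (Inf K)))"
    proof (intro sum_mono le)
      fix K assume "K \<in> \<D>"
      with D(1) obtain p q where "K = {p..q}" "p \<le> q"
        by (metis cbox_interval division_ofD(3) division_ofD(4) atLeastatMost_empty_iff2)
      with \<open>K \<in> \<D>\<close> D(2) show "Sup K \<in> S" "Inf K \<in> S" by force+
    qed
    also have "\<dots> < \<epsilon>" by (rule \<delta>(2)[OF D])
    finally show "(\<Sum>K\<in>\<D>. norm (g (Sup K) - g (Inf K))) < \<epsilon>" .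
  qed
qed

lemma partition_sum_eq_division_sum:
  assumes "partition_sum f a x s"
  shows "\<exists>\<D>. \<D> division_of {a..x} \<and> s = (\<Sum>K\<in>\<D>. norm (f (Sup K) - f (Inf K)))"
  using assms
proof (induction rule: partition_sum.induct)
  case start
  show ?case by (intro exI[of _ "{{a}}"]) (use division_of_self[of a a] in auto)
next
  case (snoc x s y)
  then obtain \<D> where D: "\<D> division_of {a..x}" "s = (\<Sum>K\<in>\<D>. norm (f (Sup K) - f (Inf K)))" by blast
  have ax: "a \<le> x" using snoc partition_sum_le by blast
  show ?case
  proof (cases "x = y")
    case True
    with D show ?thesis by (intro exI[of _ \<D>]) auto
  next
    case False
    with snoc have xy: "x < y" by simp
    have "{{x..y}} division_of {x..y}"
      using division_of_self[of x y] xy by simp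
    then have "\<D> \<union> {{x..y}} division_of {a..x} \<union> {x..y}"
      using D(1) by (intro division_disjoint_union) auto
    moreover have "{a..x} \<union> {x..y} = {a..y}" using ax xy by auto
    moreover have "{x..y} \<notin> \<D>"
      using division_ofD(2)[OF D(1)] xy by fastforce
    moreover have "finite \<D>" using D(1) by blast
    ultimately show ?thesis
      by (intro exI[of _ "\<D> \<union> {{x..y}}"]) (use D(2) xy in auto)
  qed
qed

text \<open>Choose the \<open>\<delta>\<close> that belongs to \<open>\<epsilon> = 1\<close>. On an interval shorter
  than \<open>\<delta>\<close> the total length of a division needs no further control, so all its
  variation sums are below 1. Since differentiability is a local property, intervals of this size
  suffice.\<close>
lemma abs_continuous_on_locally_bounded_variation:
  fixes f :: "real \<Rightarrow> real"
  assumes "abs_continuous_on S f"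
  obtains \<delta> where "\<delta> > 0" "\<And>a b. {a..b} \<subseteq> S \<Longrightarrow> b - a < \<delta> \<Longrightarrow> bounded_variation f a b"
proof -
  obtain \<delta> where \<delta>: "\<delta> > 0" "\<And>\<D>. \<D> division_of \<Union>\<D> \<Longrightarrow> \<Union>\<D> \<subseteq> S \<Longrightarrow> (\<Sum>K\<in>\<D>. measure lborel K) < \<delta> \<Longrightarrow>
      (\<Sum>K\<in>\<D>. norm (f (Sup K) - f (Inf K))) < 1"
    using assms unfolding abs_continuous_on_def by (meson zero_less_one)
  have "bounded_variation f a b" if ab: "{a..b} \<subseteq> S" "b - a < \<delta>" for a b
    unfolding bounded_variation_def
  proof (intro exI[of _ 1] allI impI)
    fix x s assume x: "partition_sum f a x s" "x \<le> b"
    have ax: "a \<le> x" using x partition_sum_le by blast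
    obtain \<D> where D: "\<D> division_of {a..x}" "s = (\<Sum>K\<in>\<D>. norm (f (Sup K) - f (Inf K)))"
      using partition_sum_eq_division_sum[OF x(1)] by blast
    have U: "\<Union>\<D> = {a..x}" using D(1) by blast
    have "(\<Sum>K\<in>\<D>. measure lborel K) = x - a"
      using additive_content_division[of \<D> a x] D(1) ax by simp
    then show "s \<le> 1"
      using \<delta>(2)[of \<D>] D ab x order_trans[of "{a..x}" "{a..b}" S] by (auto simp: U less_imp_le)
  qed
  with \<delta>(1) that show ?thesis by blast
qed

lemma abs_continuous_on_differentiable_ae_real:
  fixes f :: "real \<Rightarrow> real"
  assumes "abs_continuous_on {a..b} f"
  shows "negligible {x \<in> {a<..<b}. \<not> f differentiable (at x)}"
proof -
  obtain \<delta> where \<delta>: "\<delta> > 0" "\<And>p q. {p..q} \<subseteq> {a..b} \<Longrightarrow> q - p < \<delta> \<Longrightarrow> bounded_variation f p q"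
    using abs_continuous_on_locally_bounded_variation[OF assms] by metis
  let ?Q = "{(p, q). p \<in> \<rat> \<and> q \<in> \<rat> \<and> a \<le> p \<and> p < q \<and> q \<le> b \<and> q - p < \<delta>}"
  let ?N = "\<lambda>(p, q). {x \<in> {p<..<q}. \<not> f differentiable (at x)}"
  have "countable ?Q"
    by (rule countable_subset[of _ "\<rat> \<times> \<rat>"]) (auto simp: countable_rat)
  then have "negligible (\<Union>pq\<in>?Q. ?N pq)"
  proof (intro negligible_countable_Union)
    fix X assume "X \<in> ?N ` ?Q"
    then obtain p q where pq: "(p, q) \<in> ?Q" and X: "X = ?N (p, q)" by blast
    show "negligible X"
      unfolding X case_prod_conv
      by (intro bounded_variation_differentiable_ae \<delta>(2)) (use pq in auto)
  qed (rule countable_image)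
  then show ?thesis
  proof (rule negligible_subset, intro subsetI)
    fix x assume x: "x \<in> {x \<in> {a<..<b}. \<not> f differentiable (at x)}"
    obtain p where p: "p \<in> \<rat>" "max a (x - \<delta> / 2) < p" "p < x"
      using Rats_dense_in_real[of "max a (x - \<delta> / 2)" x] x \<delta>(1) by auto
    obtain q where q: "q \<in> \<rat>" "x < q" "q < min b (x + \<delta> / 2)"
      using Rats_dense_in_real[of x "min b (x + \<delta> / 2)"] x \<delta>(1) by auto
    have "(p, q) \<in> ?Q" "x \<in> ?N (p, q)" using p q x by auto
    then show "x \<in> (\<Union>pq\<in>?Q. ?N pq)" by blast
  qed
qed

theorem abs_continuous_on_differentiable_ae:
  fixes f :: "real \<Rightarrow> 'a::euclidean_space"
  assumes "abs_continuous_on {a..b} f"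
  shows "negligible {x \<in> {a..b}. \<not> f differentiable (at x within {a..b})}"
proof -
  let ?N = "\<lambda>i. {x \<in> {a<..<b}. \<not> (\<lambda>x. f x \<bullet> i) differentiable (at x)}"
  have "abs_continuous_on {a..b} (\<lambda>x. f x \<bullet> i)" if "i \<in> Basis" for i
    by (rule abs_continuous_on_dominated[OF assms])
      (use that in \<open>simp add: inner_diff_left[symmetric] Basis_le_norm\<close>)
  then have "negligible (?N i)" if "i \<in> Basis" for i
    using that abs_continuous_on_differentiable_ae_real by blast
  then have "negligible ({a, b} \<union> (\<Union>i\<in>Basis. ?N i))"
    by (intro negligible_Un negligible_Union) auto
  then show ?thesis
  proof (rule negligible_subset, intro subsetI)
    fix x assume x: "x \<in> {x \<in> {a..b}. \<not> f differentiable (at x within {a..b})}"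
    then obtain i where "i \<in> Basis" "\<not> (\<lambda>x. f x \<bullet> i) differentiable (at x within {a..b})"
      using differentiable_componentwise_within by blast
    then show "x \<in> {a, b} \<union> (\<Union>i\<in>Basis. ?N i)"
      using x differentiable_at_withinI by fastforce
  qed
qed

section \<open>Reflection of intervals, absolutely continuous functions and measure\<close>

lemma image_reflect_interval: "(\<lambda>x. c - x) ` {p..q} = {c - q..c - p :: real}"
proof (intro equalityI subsetI)
  fix x assume "x \<in> {c - q..c - p}"
  then show "x \<in> (\<lambda>x. c - x) ` {p..q}" by (intro image_eqI[of _ _ "c - x"]) auto
qed auto

lemma division_of_reflect:
  fixes c :: real
  assumes "\<D> division_of S"
  shows "(`) (\<lambda>x. c - x) ` \<D> division_of (\<lambda>x. c - x) ` S"
proof (rule division_ofI)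
  show "finite ((`) (\<lambda>x. c - x) ` \<D>)" using assms by blast
  show "\<Union> ((`) (\<lambda>x. c - x) ` \<D>) = (\<lambda>x. c - x) ` S" using division_ofD(6)[OF assms] by blast
  fix K assume "K \<in> (`) (\<lambda>x. c - x) ` \<D>"
  then obtain K0 where K0: "K0 \<in> \<D>" "K = (\<lambda>x. c - x) ` K0" by blast
  show "K \<subseteq> (\<lambda>x. c - x) ` S" "K \<noteq> {}"
    using K0 division_ofD(2,3)[OF assms] by auto
  obtain p q where "K0 = {p..q}" using division_ofD(4)[OF assms K0(1)] by auto
  then show "\<exists>a b. K = cbox a b" using K0 by (auto simp: image_reflect_interval)
  fix L assume "L \<in> (`) (\<lambda>x. c - x) ` \<D>"
  then obtain L0 where L0: "L0 \<in> \<D>" "L = (\<lambda>x. c - x) ` L0" by blast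
  assume "K \<noteq> L"
  then have "interior K0 \<inter> interior L0 = {}" using division_ofD(5)[OF assms K0(1) L0(1)] K0 L0 by blast
  moreover obtain p' q' where "L0 = {p'..q'}" using division_ofD(4)[OF assms L0(1)] by auto
  ultimately show "interior K \<inter> interior L = {}"
    using \<open>K0 = {p..q}\<close> K0 L0 by (auto simp: image_reflect_interval)
qed

lemma abs_continuous_on_reflect:
  fixes f :: "real \<Rightarrow> 'a::real_normed_vector"
  assumes f: "abs_continuous_on S f" and S: "(\<lambda>x. c - x) ` T \<subseteq> S"
  shows "abs_continuous_on T (\<lambda>x. f (c - x))"
  unfolding abs_continuous_on_def
proof (intro allI impI)
  fix \<epsilon> :: real assume "\<epsilon> > 0"
  then obtain \<delta> where \<delta>: "\<delta> > 0" "\<And>\<D>. \<D> division_of \<Union>\<D> \<Longrightarrow> \<Union>\<D> \<subseteq> S \<Longrightarrow> (\<Sum>K\<in>\<D>. measure lborel K) < \<delta> \<Longrightarrow>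
      (\<Sum>K\<in>\<D>. norm (f (Sup K) - f (Inf K))) < \<epsilon>"
    using f unfolding abs_continuous_on_def by meson
  show "\<exists>\<delta>>0. \<forall>\<D>. \<D> division_of \<Union>\<D> \<and> \<Union>\<D> \<subseteq> T \<and> (\<Sum>K\<in>\<D>. measure lborel K) < \<delta> \<longrightarrow>
        (\<Sum>K\<in>\<D>. norm (f (c - Sup K) - f (c - Inf K))) < \<epsilon>"
  proof (intro exI[of _ \<delta>] conjI allI impI \<delta>(1); elim conjE)
    fix \<D> :: "real set set" assume D: "\<D> division_of \<Union>\<D>" "\<Union>\<D> \<subseteq> T" "(\<Sum>K\<in>\<D>. measure lborel K) < \<delta>"
    let ?r = "(`) (\<lambda>x. c - x) :: real set \<Rightarrow> real set"
    have inj: "inj_on ?r \<D>"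
      by (rule inj_on_subset[OF _ subset_UNIV], rule inj_on_image) (auto simp: inj_on_def)
    have K: "\<exists>p q. K = {p..q} \<and> p \<le> q" if "K \<in> \<D>" for K
      using that D(1) by (metis cbox_interval division_ofD(3) division_ofD(4) atLeastatMost_empty_iff2)
    have U: "\<Union>(?r ` \<D>) = (\<lambda>x. c - x) ` \<Union>\<D>" by blast
    have "(\<Sum>K\<in>?r ` \<D>. norm (f (Sup K) - f (Inf K))) < \<epsilon>"
    proof (rule \<delta>(2))
      show "?r ` \<D> division_of \<Union>(?r ` \<D>)" unfolding U by (rule division_of_reflect[OF D(1)])
      show "\<Union>(?r ` \<D>) \<subseteq> S" unfolding U using D(2) S by blast
      have "(\<Sum>K\<in>?r ` \<D>. measure lborel K) = (\<Sum>K\<in>\<D>. measure lborel K)"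
        unfolding sum.reindex[OF inj] o_def
      proof (rule sum.cong[OF refl])
        fix K assume "K \<in> \<D>"
        then obtain p q where "K = {p..q}" "p \<le> q" using K by blast
        then show "measure lborel (?r K) = measure lborel K" by (simp add: image_reflect_interval)
      qed
      then show "(\<Sum>K\<in>?r ` \<D>. measure lborel K) < \<delta>" using D(3) by simp
    qed
    also have "(\<Sum>K\<in>?r ` \<D>. norm (f (Sup K) - f (Inf K))) = (\<Sum>K\<in>\<D>. norm (f (c - Sup K) - f (c - Inf K)))"
      unfolding sum.reindex[OF inj] o_def
    proof (rule sum.cong[OF refl])
      fix K assume "K \<in> \<D>"
      then obtain p q where "K = {p..q}" "p \<le> q" using K by blast
      then show "norm (f (Sup (?r K)) - f (Inf (?r K))) = norm (f (c - Sup K) - f (c - Inf K))"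
        by (simp add: image_reflect_interval norm_minus_commute)
    qed
    finally show "(\<Sum>K\<in>\<D>. norm (f (c - Sup K) - f (c - Inf K))) < \<epsilon>" .
  qed
qed

lemma AE_lebesgue_on_iff_negligible:
  assumes "S \<in> sets lebesgue"
  shows "(AE x in lebesgue_on S. Q x) \<longleftrightarrow> negligible {x \<in> S. \<not> Q x}"
proof -
  have "(AE x in lebesgue_on S. Q x) \<longleftrightarrow> (AE x in lebesgue. x \<in> S \<longrightarrow> Q x)"
    by (rule AE_restrict_space_iff) (use assms in auto)
  also have "\<dots> \<longleftrightarrow> negligible {x \<in> S. \<not> Q x}"
    unfolding eventually_ae_filter_negligible by (auto intro: negligible_subset)
  finally show ?thesis .
qed

lemma negligible_reflect:
  fixes c :: real
  assumes "negligible N"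
  shows "negligible ((\<lambda>x. c - x) ` N)"
  by (rule negligible_differentiable_image_negligible[OF _ assms])
    (auto intro!: derivative_intros)

lemma measurable_lebesgue_reflect: "(\<lambda>x. c - x) \<in> lebesgue \<rightarrow>\<^sub>M (lebesgue :: real measure)"
  using lebesgue_affine_measurable[where c = "\<lambda>_. -1 :: real" and t = c] by simp

lemma distr_lebesgue_reflect: "distr lebesgue lebesgue (\<lambda>x. c - x) = (lebesgue :: real measure)"
  using lebesgue_real_affine[of "-1" c] by (simp add: density_1)

lemma borel_measurable_lebesgue_on_AE:
  fixes f g :: "'a::euclidean_space \<Rightarrow> 'b::euclidean_space"
  assumes S: "S \<in> sets lebesgue" and f: "f \<in> borel_measurable (lebesgue_on S)"
    and ae: "AE x in lebesgue_on S. f x = g x"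
  shows "g \<in> borel_measurable (lebesgue_on S)"
proof -
  have S': "S \<inter> space lebesgue \<in> sets lebesgue" using S by simp
  have "(\<lambda>x. indicator S x *\<^sub>R f x) \<in> borel_measurable lebesgue"
    using f borel_measurable_restrict_space_iff[OF S', of f] by simp
  moreover have "AE x in lebesgue. indicator S x *\<^sub>R f x = indicator S x *\<^sub>R g x"
    using ae unfolding AE_restrict_space_iff[OF S'] by (auto elim!: eventually_mono simp: indicator_def)
  ultimately have "(\<lambda>x. indicator S x *\<^sub>R g x) \<in> borel_measurable lebesgue"
    by (rule borel_measurable_AE)
  then show ?thesis
    using borel_measurable_restrict_space_iff[OF S', of g] by simp
qed

lemma borel_measurable_lebesgue_on_reflect:
  fixes f :: "real \<Rightarrow> 'b::real_normed_vector"
  assumes S: "S \<in> sets lebesgue" "\<And>x. c - x \<in> S \<longleftrightarrow> x \<in> S" and f: "f \<in> borel_measurable (lebesgue_on S)"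
  shows "(\<lambda>x. f (c - x)) \<in> borel_measurable (lebesgue_on S)"
proof -
  have S': "S \<inter> space lebesgue \<in> sets lebesgue" using S by simp
  have "(\<lambda>x. indicator S x *\<^sub>R f x) \<in> borel_measurable lebesgue"
    using f borel_measurable_restrict_space_iff[OF S', of f] by simp
  from measurable_compose[OF measurable_lebesgue_reflect this]
  have "(\<lambda>x. indicator S (c - x) *\<^sub>R f (c - x)) \<in> borel_measurable lebesgue" .
  moreover have "indicator S (c - x) = (indicator S x :: real)" for x
    using S(2)[of x] by (simp add: indicator_def)
  ultimately show ?thesis
    using borel_measurable_restrict_space_iff[OF S', of "\<lambda>x. f (c - x)"] by simp
qed

lemma integrable_lebesgue_on_reflect:
  fixes f :: "real \<Rightarrow> real"
  assumes S: "S \<in> sets lebesgue" "\<And>x. c - x \<in> S \<longleftrightarrow> x \<in> S" and f: "integrable (lebesgue_on S) f"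
  shows "integrable (lebesgue_on S) (\<lambda>x. f (c - x))"
proof -
  have S': "S \<inter> space lebesgue \<in> sets lebesgue" using S by simp
  have *: "integrable lebesgue (\<lambda>x. indicator S x *\<^sub>R f x)"
    using f integrable_restrict_space[OF S', of f] by (simp add: set_integrable_def)
  have "integrable (distr lebesgue lebesgue (\<lambda>x. c - x)) (\<lambda>x. indicator S x *\<^sub>R f x)"
    unfolding distr_lebesgue_reflect by (rule *)
  then have "integrable lebesgue (\<lambda>x. indicator S (c - x) *\<^sub>R f (c - x))"
    by (rule integrable_distr[OF measurable_lebesgue_reflect])
  moreover have "indicator S (c - x) = (indicator S x :: real)" for x
    using S(2)[of x] by (simp add: indicator_def)
  ultimately show ?thesis
    using integrable_restrict_space[OF S', of "\<lambda>x. f (c - x)"] by (simp add: set_integrable_def)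
qed

section \<open>Conjugation composed with reflection\<close>

definition cnj_vec :: "complex ^ 'm \<Rightarrow> complex ^ 'm" where
  "cnj_vec v = (\<chi> i. cnj (v $ i))"

text \<open>The symmetry \<open>y(x) \<mapsto> cnj (y(\<pi> - x))\<close> is taken on the whole line. It preserves
  the functions vanishing outside \<open>{0..\<pi>}\<close>, and without a cut-off it is an involution on
  all functions.\<close>
definition conj_reflect :: "(real \<Rightarrow> complex ^ 'm) \<Rightarrow> real \<Rightarrow> complex ^ 'm" where
  "conj_reflect y = (\<lambda>x. cnj_vec (y (pi - x)))"

lemma cnj_vec_nth [simp]: "cnj_vec v $ i = cnj (v $ i)"
  by (simp add: cnj_vec_def)

lemma cnj_vec_cnj_vec [simp]: "cnj_vec (cnj_vec v) = v"
  by (simp add: vec_eq_iff)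

lemma cnj_vec_zero [simp]: "cnj_vec 0 = 0"
  by (simp add: vec_eq_iff)

lemma cnj_vec_add: "cnj_vec (u + v) = cnj_vec u + cnj_vec v"
  by (simp add: vec_eq_iff)

lemma cnj_vec_sum: "cnj_vec (\<Sum>k\<in>A. f k) = (\<Sum>k\<in>A. cnj_vec (f k))"
  by (simp add: vec_eq_iff)

lemma cnj_vec_scale: "cnj_vec (c *s v) = cnj c *s cnj_vec v"
  by (simp add: vec_eq_iff)

lemma cnj_vec_scaleR: "cnj_vec (r *\<^sub>R v) = r *\<^sub>R cnj_vec v"
  by (simp add: vec_eq_iff)

lemma norm_cnj_vec [simp]: "norm (cnj_vec v) = norm v"
  by (simp add: norm_vec_def)

lemma bounded_linear_cnj_vec: "bounded_linear cnj_vec"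
  by (rule bounded_linear_intro[where K = 1]) (simp_all add: cnj_vec_add cnj_vec_scaleR)

lemma has_vector_derivative_conj_reflect:
  fixes F G :: "real \<Rightarrow> complex ^ 'm"
  assumes x: "x \<in> {0..pi}"
    and F: "(F has_vector_derivative D) (at (pi - x) within {0..pi})"
    and G: "\<And>z. z \<in> {0..pi} \<Longrightarrow> G z = s *\<^sub>R cnj_vec (F (pi - z))"
  shows "(G has_vector_derivative (- s) *\<^sub>R cnj_vec D) (at x within {0..pi})"
proof -
  have "(\<lambda>z. pi - z) ` {0..pi} = {0..pi}" by (simp add: image_reflect_interval)
  moreover have "((\<lambda>z. pi - z) has_vector_derivative - 1) (at x within {0..pi})"
    by (auto intro!: derivative_eq_intros)
  ultimately have "((F \<circ> (\<lambda>z. pi - z)) has_vector_derivative (- 1) *\<^sub>R D) (at x within {0..pi})"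
    using F by (intro vector_diff_chain_within) auto
  then have "((\<lambda>z. s *\<^sub>R cnj_vec ((F \<circ> (\<lambda>z. pi - z)) z)) has_vector_derivative s *\<^sub>R cnj_vec ((- 1) *\<^sub>R D))
     (at x within {0..pi})"
    using bounded_linear_compose[OF bounded_linear_scaleR_right bounded_linear_cnj_vec]
    by (rule bounded_linear.has_vector_derivative[rotated])
  also have "s *\<^sub>R cnj_vec ((- 1) *\<^sub>R D) = (- s) *\<^sub>R cnj_vec D"
    unfolding cnj_vec_scaleR by simp
  finally show ?thesis
    by (rule has_vector_derivative_transform[OF x, rotated]) (simp add: G)
qed

text \<open>Differentiability is required at the single point \<open>\<pi> - x\<close> only, because the derivative
  of highest order exists just almost everywhere.\<close>
lemma iter_deriv_conj_reflect_step:
  fixes y :: "real \<Rightarrow> complex ^ 'm"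
  assumes x: "x \<in> {0..pi}"
    and diff: "iter_deriv_on {0..pi} k y differentiable (at (pi - x) within {0..pi})"
    and IH: "\<And>z. z \<in> {0..pi} \<Longrightarrow>
      iter_deriv_on {0..pi} k (conj_reflect y) z = (- 1) ^ k *\<^sub>R cnj_vec (iter_deriv_on {0..pi} k y (pi - z))"
  shows "iter_deriv_on {0..pi} k (conj_reflect y) differentiable (at x within {0..pi})"
    and "iter_deriv_on {0..pi} (Suc k) (conj_reflect y) x =
      (- 1) ^ Suc k *\<^sub>R cnj_vec (iter_deriv_on {0..pi} (Suc k) y (pi - x))"
proof -
  have "(iter_deriv_on {0..pi} k y has_vector_derivative iter_deriv_on {0..pi} (Suc k) y (pi - x))
      (at (pi - x) within {0..pi})"
    using diff by (simp add: vector_derivative_works)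
  from has_vector_derivative_conj_reflect[OF x this IH]
  have *: "(iter_deriv_on {0..pi} k (conj_reflect y) has_vector_derivative
      (- 1) ^ Suc k *\<^sub>R cnj_vec (iter_deriv_on {0..pi} (Suc k) y (pi - x))) (at x within {0..pi})"
    by simp
  then show "iter_deriv_on {0..pi} k (conj_reflect y) differentiable (at x within {0..pi})"
    using differentiableI_vector by blast
  have "at x within {0..pi} \<noteq> bot"
    using x by (simp add: trivial_limit_within islimpt_Icc)
  then show "iter_deriv_on {0..pi} (Suc k) (conj_reflect y) x =
      (- 1) ^ Suc k *\<^sub>R cnj_vec (iter_deriv_on {0..pi} (Suc k) y (pi - x))"
    using vector_derivative_within[OF _ *] by simp
qed

lemma iter_deriv_conj_reflect:
  fixes y :: "real \<Rightarrow> complex ^ 'm"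
  assumes "abs_continuous_derivs_on {0..pi} n y" and "k < n" and "x \<in> {0..pi}"
  shows "iter_deriv_on {0..pi} k (conj_reflect y) x =
    (- 1) ^ k *\<^sub>R cnj_vec (iter_deriv_on {0..pi} k y (pi - x))"
  using assms(2,3)
proof (induction k arbitrary: x)
  case 0
  then show ?case by (simp add: conj_reflect_def)
next
  case (Suc k)
  have "iter_deriv_on {0..pi} k y differentiable (at (pi - x) within {0..pi})"
    using assms(1) Suc.prems by (auto simp: abs_continuous_derivs_on_def differentiable_on_def)
  then show ?case
    using Suc.prems by (intro iter_deriv_conj_reflect_step(2) Suc.IH) auto
qed

lemma abs_continuous_derivs_conj_reflect:
  fixes y :: "real \<Rightarrow> complex ^ 'm"
  assumes y: "abs_continuous_derivs_on {0..pi} n y"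
  shows "abs_continuous_derivs_on {0..pi} n (conj_reflect y)"
  unfolding abs_continuous_derivs_on_def
proof (intro conjI allI impI)
  fix k assume k: "k < n"
  have "abs_continuous_on {0..pi} (\<lambda>x. iter_deriv_on {0..pi} k y (pi - x))"
    using y k by (intro abs_continuous_on_reflect[where S = "{0..pi}"])
      (auto simp: abs_continuous_derivs_on_def)
  then show "abs_continuous_on {0..pi} (iter_deriv_on {0..pi} k (conj_reflect y))"
  proof (rule abs_continuous_on_dominated)
    fix u v :: real assume "u \<in> {0..pi}" "v \<in> {0..pi}"
    then have "iter_deriv_on {0..pi} k (conj_reflect y) u - iter_deriv_on {0..pi} k (conj_reflect y) v
      = (- 1) ^ k *\<^sub>R cnj_vec (iter_deriv_on {0..pi} k y (pi - u) - iter_deriv_on {0..pi} k y (pi - v))"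
      by (simp only: iter_deriv_conj_reflect[OF y k])
        (simp add: linear_diff[OF bounded_linear.linear[OF bounded_linear_cnj_vec]] scaleR_diff_right)
    then show "norm (iter_deriv_on {0..pi} k (conj_reflect y) u - iter_deriv_on {0..pi} k (conj_reflect y) v)
      \<le> norm (iter_deriv_on {0..pi} k y (pi - u) - iter_deriv_on {0..pi} k y (pi - v))"
      by (simp add: power_abs)
  qed
next
  fix k assume k: "Suc k < n"
  show "iter_deriv_on {0..pi} k (conj_reflect y) differentiable_on {0..pi}"
    unfolding differentiable_on_def
  proof
    fix x assume x: "x \<in> {0..pi}"
    show "iter_deriv_on {0..pi} k (conj_reflect y) differentiable (at x within {0..pi})"
    proof (rule iter_deriv_conj_reflect_step(1)[OF x])
      show "iter_deriv_on {0..pi} k y differentiable (at (pi - x) within {0..pi})"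
        using y k x by (auto simp: abs_continuous_derivs_on_def differentiable_on_def)
    qed (use iter_deriv_conj_reflect[OF y] k in auto)
  qed
qed

section \<open>The symmetry of the operator\<close>

text \<open>The form in which periodicity and the symmetry \<open>P k (- x) = cnj (P k x)\<close> of the
  coefficients act together.\<close>
definition reflection_symmetric :: "nat \<Rightarrow> (nat \<Rightarrow> real \<Rightarrow> complex ^ 'm ^ 'm) \<Rightarrow> bool" where
  "reflection_symmetric n P \<longleftrightarrow> (\<forall>k\<le>n. \<forall>x i j. P k (pi - x) $ i $ j = cnj (P k x $ i $ j))"

text \<open>Each derivative contributes a sign to the reflection, and this sign is exactly what conjugation does
  to the corresponding power of \<open>- \<i>\<close>.\<close>
lemma diff_expr_term_conj_reflect:
  fixes A B :: "complex ^ 'm ^ 'm"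
  assumes "\<And>i j. B $ i $ j = cnj (A $ i $ j)"
  shows "(- \<i>) ^ j *s (A *v ((- 1) ^ j *\<^sub>R cnj_vec v)) = cnj_vec ((- \<i>) ^ j *s (B *v v))"
proof -
  have "A *v ((- 1) ^ j *\<^sub>R cnj_vec v) = (- 1) ^ j *s (A *v cnj_vec v)"
    by (simp add: vec_eq_iff matrix_vector_mult_def sum_distrib_left scaleR_conv_of_real[where 'a = complex] mult_ac)
  moreover have "cnj_vec (B *v v) = A *v cnj_vec v"
    using assms by (simp add: vec_eq_iff matrix_vector_mult_def)
  moreover have "(- \<i>) ^ j * (- 1) ^ j = cnj ((- \<i>) ^ j)"
  proof -
    have "(- \<i>) ^ j * (- 1) ^ j = (- \<i> * - 1) ^ j" by (rule power_mult_distrib[symmetric])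
    then show ?thesis by simp
  qed
  ultimately show ?thesis by (simp add: cnj_vec_scale vector_smult_assoc)
qed

text \<open>Where the derivative of order \<open>n\<close> does not exist, \<^const>\<open>vector_derivative\<close> is an
  arbitrary vector that need not respect the symmetry. Such points form a null set, since the
  derivative of order \<open>n - 1\<close> is absolutely continuous.\<close>
lemma diff_expr_conj_reflect_ae:
  fixes y :: "real \<Rightarrow> complex ^ 'm"
  assumes P: "reflection_symmetric n P" and y: "abs_continuous_derivs_on {0..pi} n y"
  shows "AE x in lebesgue_on {0..pi}. diff_expr n P (conj_reflect y) x = conj_reflect (diff_expr n P y) x"
proof -
  define N where "N = {x \<in> {0..pi}. n > 0 \<and> \<not> iter_deriv_on {0..pi} (n - 1) y differentiable (at x within {0..pi})}"
  have "negligible N"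
  proof (cases "n > 0")
    case True
    then have "abs_continuous_on {0..pi} (iter_deriv_on {0..pi} (n - 1) y)"
      using y by (simp add: abs_continuous_derivs_on_def)
    from abs_continuous_on_differentiable_ae[OF this] show ?thesis
      using True by (simp add: N_def)
  qed (simp add: N_def)
  then have "negligible ((\<lambda>x. pi - x) ` N)" by (rule negligible_reflect)
  moreover have "diff_expr n P (conj_reflect y) x = conj_reflect (diff_expr n P y) x"
    if x: "x \<in> {0..pi}" "x \<notin> (\<lambda>x. pi - x) ` N" for x
  proof -
    have xN: "pi - x \<notin> N"
    proof
      assume "pi - x \<in> N"
      then have "pi - (pi - x) \<in> (\<lambda>x. pi - x) ` N" by blast
      with x show False by simp
    qed
    have D: "iter_deriv_on {0..pi} j (conj_reflect y) x =
        (- 1) ^ j *\<^sub>R cnj_vec (iter_deriv_on {0..pi} j y (pi - x))" if "j \<le> n" for j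
    proof (cases "j < n")
      case True
      then show ?thesis by (rule iter_deriv_conj_reflect[OF y _ x(1)])
    next
      case False
      then have "j = n" using that by simp
      show ?thesis
      proof (cases j)
        case 0
        then show ?thesis by (simp add: conj_reflect_def)
      next
        case (Suc k)
        have "iter_deriv_on {0..pi} k y differentiable (at (pi - x) within {0..pi})"
          using xN x(1) Suc \<open>j = n\<close> by (auto simp: N_def)
        then show ?thesis
          unfolding Suc using Suc \<open>j = n\<close> x(1)
          by (intro iter_deriv_conj_reflect_step(2) iter_deriv_conj_reflect[OF y]) auto
      qed
    qed
    have "diff_expr n P (conj_reflect y) x =
       (\<Sum>k\<le>n. (- \<i>) ^ (n - k) *s (P k x *v ((- 1) ^ (n - k) *\<^sub>R cnj_vec (iter_deriv_on {0..pi} (n - k) y (pi - x)))))"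
      unfolding diff_expr_def by (intro sum.cong refl) (simp only: D diff_le_self)
    also have "\<dots> = (\<Sum>k\<le>n. cnj_vec ((- \<i>) ^ (n - k) *s (P k (pi - x) *v iter_deriv_on {0..pi} (n - k) y (pi - x))))"
      using P by (intro sum.cong refl diff_expr_term_conj_reflect) (auto simp: reflection_symmetric_def)
    also have "\<dots> = conj_reflect (diff_expr n P y) x"
      by (simp add: conj_reflect_def diff_expr_def cnj_vec_sum)
    finally show ?thesis .
  qed
  ultimately show ?thesis
    by (subst AE_lebesgue_on_iff_negligible) (auto elim!: negligible_subset)
qed

lemma square_integrable_conj_reflect:
  fixes f :: "real \<Rightarrow> complex ^ 'm"
  assumes "f square_integrable_on {0..pi}"
  shows "conj_reflect f square_integrable_on {0..pi}"
proof -
  have "(\<lambda>x. f (pi - x)) \<in> borel_measurable (lebesgue_on {0..pi})"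
    using assms by (intro borel_measurable_lebesgue_on_reflect) (auto simp: square_integrable_on_def)
  then have "(\<lambda>x. cnj_vec (f (pi - x))) \<in> borel_measurable (lebesgue_on {0..pi})"
    by (rule measurable_compose[OF _ borel_measurable_continuous_onI[OF
      linear_continuous_on[OF bounded_linear_cnj_vec]]])
  moreover have "integrable (lebesgue_on {0..pi}) (\<lambda>x. (norm (f (pi - x)))\<^sup>2)"
    using assms by (intro integrable_lebesgue_on_reflect) (auto simp: square_integrable_on_def)
  ultimately show ?thesis
    by (simp add: square_integrable_on_def conj_reflect_def)
qed

lemma square_integrable_AE:
  fixes f g :: "real \<Rightarrow> complex ^ 'm"
  assumes f: "f square_integrable_on S" and S: "S \<in> sets lebesgue"
    and ae: "AE x in lebesgue_on S. f x = g x"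
  shows "g square_integrable_on S"
proof -
  have fm: "f \<in> borel_measurable (lebesgue_on S)" using f by (simp add: square_integrable_on_def)
  have gm: "g \<in> borel_measurable (lebesgue_on S)" by (rule borel_measurable_lebesgue_on_AE[OF S fm ae])
  have "integrable (lebesgue_on S) (\<lambda>x. (norm (f x))\<^sup>2) \<longleftrightarrow> integrable (lebesgue_on S) (\<lambda>x. (norm (g x))\<^sup>2)"
    using fm gm ae by (intro integrable_cong_AE) (auto elim!: eventually_mono)
  with f gm show ?thesis by (simp add: square_integrable_on_def)
qed

lemma conj_reflect_conj_reflect [simp]: "conj_reflect (conj_reflect y) = y"
  by (simp add: conj_reflect_def)

lemma conj_reflect_add: "conj_reflect (y + z) = conj_reflect y + conj_reflect z"
  by (simp add: conj_reflect_def fun_eq_iff cnj_vec_add)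

lemma conj_reflect_scale: "conj_reflect (vscale c y) = vscale (cnj c) (conj_reflect y)"
  by (simp add: conj_reflect_def vscale_def cnj_vec_scale)

lemma conj_reflect_zero: "conj_reflect 0 = 0"
  by (simp add: conj_reflect_def fun_eq_iff)

lemma conj_reflect_eq_zero_iff [simp]: "conj_reflect y = 0 \<longleftrightarrow> y = 0"
  by (metis conj_reflect_conj_reflect conj_reflect_zero)

text \<open>Reflection exchanges the end points, which inverts the factor in the boundary conditions. Since it
  has modulus 1, conjugation restores it.\<close>
lemma Lt_domain_conj_reflect:
  fixes y :: "real \<Rightarrow> complex ^ 'm"
  assumes P: "reflection_symmetric n P" and y: "y \<in> Lt_domain n P t"
  shows "conj_reflect y \<in> Lt_domain n P t"
proof -
  have zero: "\<And>x. x \<notin> {0..pi} \<Longrightarrow> y x = 0" and ac: "abs_continuous_derivs_on {0..pi} n y"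
    and sq: "diff_expr n P y square_integrable_on {0..pi}"
    and bc: "\<And>k. k < n \<Longrightarrow> iter_deriv_on {0..pi} k y pi =
            exp (\<i> * complex_of_real (pi * t)) *s iter_deriv_on {0..pi} k y 0"
    using y by (auto simp: Lt_domain_def)
  have "conj_reflect y x = 0" if "x \<notin> {0..pi}" for x
    using zero[of "pi - x"] that by (auto simp: conj_reflect_def)
  moreover have "diff_expr n P (conj_reflect y) square_integrable_on {0..pi}"
  proof (rule square_integrable_AE[OF square_integrable_conj_reflect[OF sq]])
    show "AE x in lebesgue_on {0..pi}. conj_reflect (diff_expr n P y) x = diff_expr n P (conj_reflect y) x"
      using diff_expr_conj_reflect_ae[OF P ac] by eventually_elim (rule sym)
  qed simp
  moreover have "iter_deriv_on {0..pi} k (conj_reflect y) pi =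
      exp (\<i> * complex_of_real (pi * t)) *s iter_deriv_on {0..pi} k (conj_reflect y) 0" if k: "k < n" for k
  proof -
    let ?e = "exp (\<i> * complex_of_real (pi * t))"
    have e: "?e * cnj ?e = 1" unfolding complex_norm_square[symmetric] norm_exp_i_times by simp
    have 0: "iter_deriv_on {0..pi} k (conj_reflect y) 0 = (- 1) ^ k *\<^sub>R (cnj ?e *s cnj_vec (iter_deriv_on {0..pi} k y 0))"
      using iter_deriv_conj_reflect[OF ac k, of 0] bc[OF k] by (simp add: cnj_vec_scale)
    have pi: "iter_deriv_on {0..pi} k (conj_reflect y) pi = (- 1) ^ k *\<^sub>R cnj_vec (iter_deriv_on {0..pi} k y 0)"
      using iter_deriv_conj_reflect[OF ac k, of pi] by simp
    have "?e *s (r *\<^sub>R (cnj ?e *s v)) = r *\<^sub>R v" for r and v :: "complex ^ 'm"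
    proof -
      have "?e *s (r *\<^sub>R (cnj ?e *s v)) = r *\<^sub>R ((?e * cnj ?e) *s v)"
        by (simp add: vec_eq_iff)
      then show ?thesis by (simp only: e vector_smult_lid)
    qed
    then show ?thesis unfolding 0 pi by simp
  qed
  ultimately show ?thesis
    using abs_continuous_derivs_conj_reflect[OF ac] unfolding Lt_domain_def by blast
qed

lemma AE_lebesgue_on_conj_reflect:
  assumes "AE x in lebesgue_on {0..pi}. f x = g x"
  shows "AE x in lebesgue_on {0..pi}. conj_reflect f x = conj_reflect g x"
proof -
  have "negligible {x \<in> {0..pi}. f x \<noteq> g x}"
    using assms AE_lebesgue_on_iff_negligible[of "{0..pi}"] by simp
  then have "negligible ((\<lambda>x. pi - x) ` {x \<in> {0..pi}. f x \<noteq> g x})"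
    by (rule negligible_reflect)
  moreover have "{x \<in> {0..pi}. conj_reflect f x \<noteq> conj_reflect g x} \<subseteq> (\<lambda>x. pi - x) ` {x \<in> {0..pi}. f x \<noteq> g x}"
  proof
    fix x assume "x \<in> {x \<in> {0..pi}. conj_reflect f x \<noteq> conj_reflect g x}"
    then show "x \<in> (\<lambda>x. pi - x) ` {x \<in> {0..pi}. f x \<noteq> g x}"
      by (intro image_eqI[of _ _ "pi - x"]) (auto simp: conj_reflect_def)
  qed
  ultimately show ?thesis
    using AE_lebesgue_on_iff_negligible[of "{0..pi}"] negligible_subset by simp blast
qed

lemma Lt_maps_conj_reflect:
  assumes P: "reflection_symmetric n P" and "Lt_maps n P t y f"
  shows "Lt_maps n P t (conj_reflect y) (conj_reflect f)"
proof -
  have y: "y \<in> Lt_domain n P t" and f: "AE x in lebesgue_on {0..pi}. diff_expr n P y x = f x"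
    using assms by (auto simp: Lt_maps_def)
  have "abs_continuous_derivs_on {0..pi} n y" using y by (simp add: Lt_domain_def)
  from diff_expr_conj_reflect_ae[OF P this] AE_lebesgue_on_conj_reflect[OF f]
  have "AE x in lebesgue_on {0..pi}. diff_expr n P (conj_reflect y) x = conj_reflect f x"
    by eventually_elim simp
  with Lt_domain_conj_reflect[OF P y] show ?thesis by (simp add: Lt_maps_def)
qed

text \<open>As the symmetry is antilinear and commutes with the operator, it turns \<open>L y = \<mu> y + z\<close> into
  the same equation for the reflected functions, with \<open>cnj \<mu>\<close>.\<close>
lemma root_functions_conj_reflect_subset:
  assumes P: "reflection_symmetric n P"
  shows "conj_reflect ` root_functions n P t \<mu> \<subseteq> root_functions n P t (cnj \<mu>)"
proof clarify
  fix y assume "y \<in> root_functions n P t \<mu>"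
  then show "conj_reflect y \<in> root_functions n P t (cnj \<mu>)"
  proof (induction rule: root_functions.induct)
    case (eigenfunction y)
    then show ?case
      using Lt_maps_conj_reflect[OF P eigenfunction(2)]
      by (auto intro: root_functions.eigenfunction simp: conj_reflect_scale)
  next
    case (associated_function z y)
    then show ?case
      using Lt_maps_conj_reflect[OF P associated_function(2)]
      by (simp add: conj_reflect_scale conj_reflect_add root_functions.associated_function)
  qed
qed

lemma root_functions_cnj:
  assumes P: "reflection_symmetric n P"
  shows "root_functions n P t (cnj \<mu>) = conj_reflect ` root_functions n P t \<mu>"
proof
  show "conj_reflect ` root_functions n P t \<mu> \<subseteq> root_functions n P t (cnj \<mu>)"
    by (rule root_functions_conj_reflect_subset[OF P])
  show "root_functions n P t (cnj \<mu>) \<subseteq> conj_reflect ` root_functions n P t \<mu>"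
  proof
    fix y assume "y \<in> root_functions n P t (cnj \<mu>)"
    then have "conj_reflect y \<in> root_functions n P t \<mu>"
      using root_functions_conj_reflect_subset[OF P, of t "cnj \<mu>"] by auto
    then show "y \<in> conj_reflect ` root_functions n P t \<mu>"
      by (intro image_eqI[of _ _ "conj_reflect y"]) simp_all
  qed
qed

section \<open>Antilinear invariance of dimension\<close>

lemma vspan_conj_reflect_subset: "conj_reflect ` vspan B \<subseteq> vspan (conj_reflect ` B)"
proof clarify
  fix y assume "y \<in> vspan B"
  then show "conj_reflect y \<in> vspan (conj_reflect ` B)"
  proof (induction rule: vfun.span_induct_alt)
    case base
    show ?case unfolding conj_reflect_zero by (rule vfun.span_zero)
  next
    case (step c x y)
    show ?case
      unfolding conj_reflect_add conj_reflect_scale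
      by (rule vfun.span_add[OF vfun.span_scale[OF vfun.span_base[OF imageI[OF step(1)]]] step(2)])
  qed
qed

lemma vspan_conj_reflect: "vspan (conj_reflect ` B) = conj_reflect ` vspan B"
proof
  have "conj_reflect ` vspan (conj_reflect ` B) \<subseteq> vspan B"
    using vspan_conj_reflect_subset[of "conj_reflect ` B"] by (simp add: image_image)
  then have "conj_reflect ` conj_reflect ` vspan (conj_reflect ` B) \<subseteq> conj_reflect ` vspan B"
    by blast
  then show "vspan (conj_reflect ` B) \<subseteq> conj_reflect ` vspan B" by (simp add: image_image)
qed (rule vspan_conj_reflect_subset)

lemma inj_conj_reflect: "inj conj_reflect"
  by (metis conj_reflect_conj_reflect injI)

text \<open>An antilinear bijection is not a linear map of the vector space, but it commutes with spans, and so
  carries bases to bases.\<close>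
lemma vdim_conj_reflect:
  "vdim (conj_reflect ` V) = vdim V"
proof -
  obtain B where B: "B \<subseteq> V" "vfun.independent B" "V \<subseteq> vspan B" "card B = vdim V"
    using vfun.basis_exists by blast
  have "vfun.independent (conj_reflect ` B)"
    unfolding vfun.dependent_def
  proof clarify
    fix b assume b: "b \<in> B" "conj_reflect b \<in> vspan (conj_reflect ` B - {conj_reflect b})"
    have "conj_reflect ` B - {conj_reflect b} = conj_reflect ` (B - {b})"
      using inj_conj_reflect by (auto simp: inj_def)
    then have "b \<in> vspan (B - {b})"
      using b(2) inj_conj_reflect by (auto simp: vspan_conj_reflect inj_def)
    then show False using B(2) b(1) by (auto simp: vfun.dependent_def)
  qed
  moreover have "conj_reflect ` B \<subseteq> conj_reflect ` V" "conj_reflect ` V \<subseteq> vspan (conj_reflect ` B)"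
    using B by (auto simp: vspan_conj_reflect)
  moreover have "card (conj_reflect ` B) = vdim V"
    using B(4) by (simp add: card_image inj_on_subset[OF inj_conj_reflect])
  ultimately show ?thesis by (intro vfun.dim_unique)
qed

lemma edim_conj_reflect: "edim (conj_reflect ` V) = edim V"
proof -
  have finite_span: "\<exists>B. finite B \<and> conj_reflect ` V \<subseteq> vspan B" if "finite B" "V \<subseteq> vspan B" for V B
    using that by (intro exI[of _ "conj_reflect ` B"]) (auto simp: vspan_conj_reflect)
  have "(\<exists>B. finite B \<and> conj_reflect ` V \<subseteq> vspan B) \<longleftrightarrow> (\<exists>B. finite B \<and> V \<subseteq> vspan B)"
  proof
    assume "\<exists>B. finite B \<and> conj_reflect ` V \<subseteq> vspan B"
    then have "\<exists>B. finite B \<and> conj_reflect ` conj_reflect ` V \<subseteq> vspan B" using finite_span by blast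
    then show "\<exists>B. finite B \<and> V \<subseteq> vspan B" by (simp add: image_image)
  qed (use finite_span in blast)
  then show ?thesis by (simp add: edim_def vdim_conj_reflect)
qed

section \<open>Symmetry of the spectrum\<close>

theorem theorem2:
  fixes n :: nat and t :: real
    and P :: "nat \<Rightarrow> real \<Rightarrow> complex ^ 'm ^ 'm"
    and \<mu> :: complex and v :: enat
  assumes "n \<ge> 1" and "0 \<le> t" and "t < 2"
    and "\<And>k i j. k \<le> n \<Longrightarrow> (\<lambda>x. P k x $ i $ j) \<in> sobolev1 (n - k) {0..pi}"
    and "\<And>k i j x. k \<le> n \<Longrightarrow> P k (x + pi) $ i $ j = P k x $ i $ j"
    and "\<And>k i j x. k \<le> n \<Longrightarrow> P k (- x) $ i $ j = cnj (P k x $ i $ j)"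
    and "\<And>x. det (P 0 x) \<noteq> 0"
    and "is_eigenvalue n P t \<mu>" and "multiplicity_of n P t \<mu> = v"
  shows "is_eigenvalue n P t (cnj \<mu>) \<and> multiplicity_of n P t (cnj \<mu>) = v"
proof
  have P: "reflection_symmetric n P"
    unfolding reflection_symmetric_def
  proof (intro allI impI)
    fix k x i j assume "k \<le> n"
    then show "P k (pi - x) $ i $ j = cnj (P k x $ i $ j)"
      using assms(5)[of k "- x" i j] assms(6)[of k x i j] by simp
  qed
  obtain y where y: "y \<noteq> 0" "Lt_maps n P t y (vscale \<mu> y)"
    using assms(8) by (auto simp: is_eigenvalue_def)
  have "Lt_maps n P t (conj_reflect y) (vscale (cnj \<mu>) (conj_reflect y))"
    using Lt_maps_conj_reflect[OF P y(2)] by (simp add: conj_reflect_scale)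
  moreover have "conj_reflect y \<noteq> 0" using y(1) by simp
  ultimately show "is_eigenvalue n P t (cnj \<mu>)"
    unfolding is_eigenvalue_def by blast
  show "multiplicity_of n P t (cnj \<mu>) = v"
    using assms(9) by (simp add: multiplicity_of_def root_functions_cnj[OF P] vspan_conj_reflect edim_conj_reflect)
qed

end
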